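(* Let $(Q,+)$ be a group, $\varphi,\psi\in Aut(Q,+)$, $\beta,\gamma\in S_Q$, and let $\overline{\psi}=I\psi$ (so $\overline{\psi}y=-\psi y$). The quasigroup $(Q,\cdot)$ given by $x\cdot y=\varphi y+\beta x$ and the right alinear quasigroup $(Q,\circ)$ given by $x\circ y=\gamma x+\overline{\psi}y$ are orthogonal if and only if the mapping $(\psi^{-1}\gamma+\varphi^{-1}\beta)$, i.e. $x\mapsto\psi^{-1}\gamma x+\varphi^{-1}\beta x$, is a permutation of the set $Q$.
   Context: Groups are written additively but need not be commutative. $S_Q$ is the set of all permutations (bijections) of the set $Q$. Products of maps are compositions, $(\alpha\beta)x=\alpha(\beta x)$. $I$ denotes the map $Ix=-x$; every anti-automorphism $\overline{\psi}$ of the group $(Q,+)$ (a permutation of $Q$ with $\overline{\psi}(x+y)=\overline{\psi}y+\overline{\psi}x$) is written $\overline{\psi}=I\psi$ with $\psi\in Aut(Q,+)$. Two quasigroups $(Q,\cdot)$ and $(Q,\circ)$ on the same set are orthogonal if for all $a,b\in Q$ the system $x\cdot y=a$, $x\circ y=b$ has a unique solution $(x,y)\in Q\times Q$. *)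

theory Defs
  imports Main
begin

text \<open>
  The set \<open>Q\<close> is the universe of a type. Where a group structure is needed, the type has class
  \<^class>\<open>group_add\<close>, in which addition is not assumed commutative. The permutations of \<open>Q\<close> are the
  functions satisfying \<^const>\<open>bij\<close>.
\<close>

definition quasigroup :: "('a \<Rightarrow> 'a \<Rightarrow> 'a) \<Rightarrow> bool" where
  "quasigroup A \<longleftrightarrow> (\<forall>a b. (\<exists>!x. A a x = b) \<and> (\<exists>!y. A y a = b))"

definition orthogonal_quasigroups :: "('a \<Rightarrow> 'a \<Rightarrow> 'a) \<Rightarrow> ('a \<Rightarrow> 'a \<Rightarrow> 'a) \<Rightarrow> bool" where
  "orthogonal_quasigroups A B \<longleftrightarrow>
     quasigroup A \<and> quasigroup B \<and> (\<forall>a b. \<exists>!(x, y). A x y = a \<and> B x y = b)"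

definition automorphism :: "('a::group_add \<Rightarrow> 'a) \<Rightarrow> bool" where
  "automorphism f \<longleftrightarrow> bij f \<and> (\<forall>x y. f (x + y) = f x + f y)"

definition anti_automorphism :: "('a::group_add \<Rightarrow> 'a) \<Rightarrow> bool" where
  "anti_automorphism f \<longleftrightarrow> bij f \<and> (\<forall>x y. f (x + y) = f y + f x)"

text \<open>
  Right alinearity is relative to the ambient group. A constant summand between the two terms
  needs no separate mention, since it can be absorbed into the permutation \<open>\<gamma>\<close>.
\<close>

definition right_alinear_quasigroup :: "('a::group_add \<Rightarrow> 'a \<Rightarrow> 'a) \<Rightarrow> bool" where
  "right_alinear_quasigroup A \<longleftrightarrow>
     quasigroup A \<and>
     (\<exists>\<gamma> \<chi>. bij \<gamma> \<and> anti_automorphism \<chi> \<and> (\<forall>x y. A x y = \<gamma> x + \<chi> y))"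

end

theory Submission
  imports Defs
begin

text \<open>
  Applying \<open>\<phi>\<^sup>-\<^sup>1\<close> and \<open>\<psi>\<^sup>-\<^sup>1\<close> turns the system \<open>x \<cdot> y = a\<close>, \<open>x \<circ> y = b\<close> into
  \<open>y + \<phi>\<^sup>-\<^sup>1\<beta>x = \<phi>\<^sup>-\<^sup>1a\<close>, \<open>\<psi>\<^sup>-\<^sup>1\<gamma>x - y = \<psi>\<^sup>-\<^sup>1b\<close>. Adding the first equation to the second on the
  right cancels \<open>y\<close>, so the system amounts to \<open>\<psi>\<^sup>-\<^sup>1\<gamma>x + \<phi>\<^sup>-\<^sup>1\<beta>x = \<psi>\<^sup>-\<^sup>1b + \<phi>\<^sup>-\<^sup>1a\<close>, with \<open>y\<close>
  determined by \<open>x\<close>; its right-hand side takes every value.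
\<close>

lemma automorphism_bij: "automorphism f \<Longrightarrow> bij f"
  by (simp add: automorphism_def)

lemma automorphism_add: "automorphism f \<Longrightarrow> f (x + y) = f x + f y"
  by (simp add: automorphism_def)

lemma automorphism_inv:
  assumes "automorphism f"
  shows "automorphism (inv f)"
  unfolding automorphism_def
proof (intro conjI allI)
  have b: "bij f" using assms by (rule automorphism_bij)
  then show "bij (inv f)" by (rule bij_imp_bij_inv)
  fix x y
  have "f (inv f x + inv f y) = x + y"
    using b by (simp add: automorphism_add[OF assms] bij_is_surj surj_f_inv_f)
  then show "inv f (x + y) = inv f x + inv f y"
    using b by (metis bij_inv_eq_iff)
qed

text \<open>Negation reverses the order of summands:
  \<open>- (f x + f y) = - f y + - f x\<close>.\<close>

lemma anti_automorphism_uminus: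
  assumes "automorphism f"
  shows "anti_automorphism (\<lambda>x. - f x)"
proof -
  have "bij (uminus \<circ> f)"
    using automorphism_bij[OF assms] bij_uminus by (rule bij_comp)
  then show ?thesis
    by (simp add: anti_automorphism_def automorphism_add[OF assms] comp_def minus_add)
qed

text \<open>Cancelling the known summand on its own side isolates \<open>f x\<close> or
  \<open>g y\<close>, and a bijection takes each value exactly once. Without commutativity the two
  orders of summands are separate cases; \<open>A\<close> has one and \<open>B\<close> the
  other.\<close>

lemma quasigroup_bij_plus_bij:
  fixes f g :: "'a::group_add \<Rightarrow> 'a"
  assumes "bij f" and "bij g"
  shows "quasigroup (\<lambda>x y. f x + g y)" and "quasigroup (\<lambda>x y. g y + f x)"
proof -
  have solve: "f x + g y = c \<longleftrightarrow> g y = - f x + c" "f x + g y = c \<longleftrightarrow> f x = c - g y"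
    "g y + f x = c \<longleftrightarrow> g y = c - f x" "g y + f x = c \<longleftrightarrow> f x = - g y + c" for x y c
    by (auto simp: add.assoc[symmetric] eq_diff_eq)
  have ex1: "\<exists>!x. f x = c" "\<exists>!x. g x = c" for c
    using assms by (simp_all add: bij_iff)
  have "\<exists>!y. f x + g y = c" "\<exists>!y. g y + f x = c" for x c
    by (simp_all only: solve(1,3) ex1)
  moreover have "\<exists>!x. f x + g y = c" "\<exists>!x. g y + f x = c" for y c
    by (simp_all only: solve(2,4) ex1)
  ultimately show "quasigroup (\<lambda>x y. f x + g y)" "quasigroup (\<lambda>x y. g y + f x)"
    by (simp_all add: quasigroup_def)
qed

theorem theorem32:
  fixes \<phi> \<psi> \<psi>' \<beta> \<gamma> :: "'a::group_add \<Rightarrow> 'a"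
    and A B :: "'a \<Rightarrow> 'a \<Rightarrow> 'a"
  assumes "automorphism \<phi>" and "automorphism \<psi>"
    and "bij \<beta>" and "bij \<gamma>"
    and "\<And>y. \<psi>' y = - \<psi> y"
    and "\<And>x y. A x y = \<phi> y + \<beta> x"
    and "\<And>x y. B x y = \<gamma> x + \<psi>' y"
  shows "quasigroup A \<and> right_alinear_quasigroup B \<and>
    (orthogonal_quasigroups A B \<longleftrightarrow> bij (\<lambda>x. inv \<psi> (\<gamma> x) + inv \<phi> (\<beta> x)))"
proof -
  define h where "h = (\<lambda>x. inv \<psi> (\<gamma> x) + inv \<phi> (\<beta> x))"
  note bij = automorphism_bij[OF assms(1)] automorphism_bij[OF assms(2)]
  have \<psi>': "\<psi>' = (\<lambda>y. - \<psi> y)" using assms(5) by blast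
  have A: "A = (\<lambda>x y. \<phi> y + \<beta> x)" using assms(6) by blast
  have B: "B = (\<lambda>x y. \<gamma> x + \<psi>' y)" using assms(7) by blast
  have anti: "anti_automorphism \<psi>'"
    unfolding \<psi>' by (rule anti_automorphism_uminus[OF assms(2)])
  have qA: "quasigroup A"
    unfolding A by (rule quasigroup_bij_plus_bij(2)[OF assms(3) bij(1)])
  have qB: "quasigroup B"
    unfolding B using assms(4) anti
    by (intro quasigroup_bij_plus_bij(1)) (simp_all add: anti_automorphism_def)
  have rB: "right_alinear_quasigroup B"
    using qB assms(4,7) anti by (auto simp: right_alinear_quasigroup_def)
  have system: "A x y = a \<and> B x y = b \<longleftrightarrow>
      y = inv \<phi> a - inv \<phi> (\<beta> x) \<and> h x = inv \<psi> b + inv \<phi> a" for x y a b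
  proof -
    have "A x y = a \<longleftrightarrow> inv \<phi> (\<phi> y + \<beta> x) = inv \<phi> a"
      unfolding A using bij_imp_bij_inv[OF bij(1)] by (simp add: bij_is_inj inj_eq)
    also have "\<dots> \<longleftrightarrow> y = inv \<phi> a - inv \<phi> (\<beta> x)"
      using bij(1) by (simp add: automorphism_add[OF automorphism_inv[OF assms(1)]]
          bij_is_inj eq_diff_eq)
    finally have 1: "A x y = a \<longleftrightarrow> y = inv \<phi> a - inv \<phi> (\<beta> x)" .
    \<comment> \<open>Moving \<open>\<psi> y\<close> across first leaves a sum, so additivity of
      \<open>inv \<psi>\<close> suffices and no negative has to pass through it.\<close>
    have "B x y = b \<longleftrightarrow> \<gamma> x = b + \<psi> y"
      unfolding B \<psi>' by (simp add: diff_eq_eq)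
    also have "\<dots> \<longleftrightarrow> inv \<psi> (\<gamma> x) = inv \<psi> (b + \<psi> y)"
      using bij_imp_bij_inv[OF bij(2)] by (simp add: bij_is_inj inj_eq)
    also have "\<dots> \<longleftrightarrow> inv \<psi> (\<gamma> x) = inv \<psi> b + y"
      using bij(2) by (simp add: automorphism_add[OF automorphism_inv[OF assms(2)]] bij_is_inj)
    finally have 2: "B x y = b \<longleftrightarrow> inv \<psi> (\<gamma> x) = inv \<psi> b + y" .
    \<comment> \<open>The value of \<open>y\<close> from \<open>1\<close> is put into
      \<open>2\<close>; adding \<open>inv \<phi> (\<beta> x)\<close> on the right produces
      \<open>h x\<close> with its summands in the required order.\<close>
    have "inv \<psi> (\<gamma> x) = inv \<psi> b + (inv \<phi> a - inv \<phi> (\<beta> x)) \<longleftrightarrow> h x = inv \<psi> b + inv \<phi> a"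
      by (simp add: h_def add_diff_eq eq_diff_eq)
    with 1 2 show ?thesis by auto
  qed
  \<comment> \<open>Since \<open>y\<close> is a function of \<open>x\<close>, solution pairs
    correspond to solutions \<open>x\<close> of the second condition.\<close>
  have unique: "(\<exists>!(x, y). A x y = a \<and> B x y = b) \<longleftrightarrow> (\<exists>!x. h x = inv \<psi> b + inv \<phi> a)" for a b
    unfolding system by (auto simp: Ex1_def)
  have "(\<forall>a b. \<exists>!(x, y). A x y = a \<and> B x y = b) \<longleftrightarrow> (\<forall>c. \<exists>!x. h x = c)"
  proof
    assume L: "\<forall>a b. \<exists>!(x, y). A x y = a \<and> B x y = b"
    show "\<forall>c. \<exists>!x. h x = c"
    proof
      fix c
      \<comment> \<open>The value \<open>c\<close> arises from \<open>a = 0\<close> and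
        \<open>b = \<psi> (c - inv \<phi> 0)\<close>; \<open>inv \<phi> 0\<close> cancels without
        being evaluated.\<close>
      have "inv \<psi> (\<psi> (c - inv \<phi> 0)) + inv \<phi> 0 = c"
        using bij(2) by (simp add: bij_is_inj)
      moreover have "\<exists>!x. h x = inv \<psi> (\<psi> (c - inv \<phi> 0)) + inv \<phi> 0"
        using L unfolding unique by blast
      ultimately show "\<exists>!x. h x = c"
        by simp
    qed
  qed (simp add: unique)
  then have "orthogonal_quasigroups A B \<longleftrightarrow> bij h"
    using qA qB by (simp add: orthogonal_quasigroups_def bij_iff)
  with qA rB show ?thesis by (simp add: h_def)
qed

end
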